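(* Let $(r,\omega)$ be a response function and a warning mechanism for which there is some $\eta\in(0,1-\mu_a)$ such that, with $\boldsymbol{\mu}_\eta=(0,\eta,1-\eta-\mu_a)$ and $$g_u(\beta)=\alpha_u\eta+(1-\eta-\mu_a)\,r(\alpha_u,\omega(\beta))-\beta,\qquad u\in\{R,F\},$$ (the right-hand side of the tagging ODE $\dot\beta_u=g_u(\beta_u)$ for the profile $\boldsymbol{\mu}_\eta$), the following hold: (B.i) there exists $\beta_R^\eta\in[0,\delta_a(\boldsymbol{\mu}_\eta)]$ with $g_R(\beta_R^\eta)=0$; (B.ii) there exists $\beta_F^\eta\in[\theta_a(\boldsymbol{\mu}_\eta),1]$ with $g_F(\beta_F^\eta)=0$; (B.iii) for each $u\in\{R,F\}$ the ODE $\dot\beta_u=g_u(\beta_u)$ has no other equilibrium point in $[0,1]$; (B.iv) for each $u\in\{R,F\}$ the derivative of $g_u$ at $\beta_u^\eta$ is strictly negative. Then, for each $u\in\{R,F\}$, $\beta_u^\eta$ is asymptotically stable for $\dot\beta_u=g_u(\beta_u)$ with domain of attraction $[0,1]$. Further, choose $\gamma$ and $R$ such that $$\gamma>\underline{\gamma}(\eta):=\frac{1}{1-p}\left(\frac{1-(\eta+\mu_a)(1-p)}{1-\eta-\mu_a}\right)\quad\text{and}\quad R=C_e\left(1-\eta-\mu_a+\frac{1}{\gamma-1}\right).$$ Then $\mathcal{G}(R,\gamma,\omega)$ is an AI game with the following properties: (a) $\boldsymbol{\mu}_\eta$ is an AI-NE; (b) for any $x\in[0,\eta)\cup\{1-\mu_a\}$,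 the profile $\boldsymbol{\mu}_x=(0,x,1-x-\mu_a)$ is not an NE; (c) no profile $\boldsymbol{\mu}$ with $\mu_0>0$ is an NE.
   Context: Parameters: $0<\alpha_R<\alpha_F<1$, $p\in(0,1)$, $\mu_a\in[0,1)$, $C_e>0$, $Q_p>0$, $Q_{np}\in\mathbb{R}$ with $Q_{np}\le Q_p$; target levels $\theta,\delta\in(0,1]$ with $\theta>\alpha_F$, $\delta>\alpha_R$, $\theta>\delta$. Design parameters: $R>0$, $\gamma>1$, and a warning mechanism $\omega:[0,1]\to\mathbb{R}^+$. The index $u\in\{R,F\}$ is the actuality (real/fake) of a post; a post is fake with probability $p$. Response function: $r(\alpha,\omega)=\min\{h(\alpha,\omega),1\}\in[0,1]$ with $h$ Lipschitz continuous, and the map $\beta\mapsto r(\alpha_u,\omega(\beta))$ is Lipschitz continuous for each $u$. Profiles: $\boldsymbol{\mu}=(\mu_0,\mu_1,\mu_2)$ with $\mu_i\ge 0$ and $\mu_0+\mu_1+\mu_2=1-\mu_a$, where $\mu_i$ is the fraction of users choosing action $i\in\{0,1,2\}$ (0: do not participate; 1: tag using innate ability only; 2: tag using also the warning) and $\mu_a$ is the fixed fraction of adversarial users. For $\mu_0<1-\mu_a$ put $$\eta(\boldsymbol{\mu})=\frac{\mu_1}{\mu_1+\mu_2+\mu_a},\quad \eta_a(\boldsymbol{\mu})=\frac{\mu_a}{\mu_1+\mu_2+\mu_a},\quad \theta_a(\boldsymbol{\mu})=\theta(1-\eta_a(\boldsymbol{\mu})),\quad \delta_a(\boldsymbol{\mu})=\delta(1-\eta_a(\boldsymbol{\mu})).$$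 For $x\in[0,1-\mu_a]$, $\boldsymbol{\mu}_x:=(0,x,1-x-\mu_a)$. Tagging dynamics: given $\boldsymbol{\mu}$ and $u$, participants tag one after the other; $\beta_{u,k}$ is the proportion of "fake" tags after the $k$-th tag, $\beta_{u,k+1}=\beta_{u,k}+\frac{1}{k+1}\left(1_{\{\text{the }(k+1)\text{-th tag is fake}\}}-\beta_{u,k}\right)$. At each epoch the participant is adversarial with probability $\eta_a$ (and always tags "real"), of type 1 with probability $\eta$ (tags "fake" with probability $\alpha_u$), of type 2 with probability $1-\eta-\eta_a$ (tags "fake" with probability $r(\alpha_u,\omega(\beta_{u,k}))$). So, given the past, the next tag is fake with probability $\alpha_u\eta+(1-\eta-\eta_a)r(\alpha_u,\omega(\beta_{u,k}))$. The associated ODE is $\dot\beta_u=g_u(\beta_u)$ with $g_u(\beta)=\alpha_u\eta+(1-\eta-\eta_a)r(\alpha_u,\omega(\beta))-\beta$. Let $\mathcal{A}_u$ be its asymptotically stable set in $[0,1]$; its domain of attraction is $\mathcal{D}_u=\{\beta\in[0,1]:\beta_u(t)\to\mathcal{A}_u\text{ as }t\to\infty\text{ if }\beta_u(0)=\beta\}$. Standing assumption: $\mathcal{A}_u$ is a singleton for each $\boldsymbol{\mu}$ and $P(\beta_{u,k}\in\mathcal{D}_u\text{ infinitely often})=1$. Success probability: for $\mu_0<1-\mu_a$, $$P_{\boldsymbol{\mu}}(S;\theta,\delta)=p\liminf_{k\to\infty}P_{\boldsymbol{\mu}}(\beta_{F,k}\ge\theta_a(\boldsymbol{\mu}))+(1-p)\liminf_{k\to\infty}P_{\boldsymbol{\mu}}(\beta_{R,k}\le\delta_a(\boldsymbol{\mu})),$$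 and $P_{(1-\mu_a,0,0)}(S;\theta,\delta):=0$. Mean-field game $\mathcal{G}(R,\gamma,\omega)$: action set $\{0,1,2\}$ with utilities $$U(0,\boldsymbol{\mu})=Q_{np},\quad U(1,\boldsymbol{\mu})=Q_p+\frac{R\,P_{\boldsymbol{\mu}}(S;\theta,\delta)}{\mu_1+\mu_a+\gamma\mu_2},\quad U(2,\boldsymbol{\mu})=Q_p-C_e+\frac{\gamma R\,P_{\boldsymbol{\mu}}(S;\theta,\delta)}{\mu_1+\mu_a+\gamma\mu_2}.$$ A profile $\boldsymbol{\mu}$ is a Nash equilibrium (NE) if $\{s:\mu_s>0\}\subseteq\arg\max_{s\in\{0,1,2\}}U(s,\boldsymbol{\mu})$. An NE $\boldsymbol{\mu}^*$ is an AI-NE if $\liminf_k P_{\boldsymbol{\mu}^*}(\beta_{F,k}\ge\theta_a(\boldsymbol{\mu}^* ))=1$ and $\liminf_k P_{\boldsymbol{\mu}^*}(\beta_{R,k}\le\delta_a(\boldsymbol{\mu}^* ))=1$. The game is an AI (actuality identification) game if it has at least one AI-NE.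
   Formalization: The AI-game claim and (a) are proved when β_R<δ_a and β_F>θ_a strictly (with equality the tag share fluctuates around the threshold and (a) fails); in (c) the profile (1−μ_a,0,0) is excepted when Q_np=Q_p, since it is then an NE. *)

theory Defs
  imports "HOL-Probability.Probability"
begin

section \<open>Scalar ODEs on the unit interval\<close>

text \<open>
  Right-hand sides are only meaningful on [0,1], so solutions are global forward solutions that
  stay in [0,1].  The right-hand sides used below are Lipschitz on [0,1], nonnegative at 0 and
  nonpositive at 1, so there is exactly one such solution for each starting point in [0,1];
  quantifying over all solutions is therefore not vacuous.
\<close>

definition solves_ode01 :: "(real \<Rightarrow> real) \<Rightarrow> (real \<Rightarrow> real) \<Rightarrow> bool" where
  "solves_ode01 g x \<longleftrightarrow>
     (\<forall>t\<ge>0. x t \<in> {0..1} \<and> (x has_real_derivative g (x t)) (at t within {0..}))"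

definition lyapunov_stable :: "(real \<Rightarrow> real) \<Rightarrow> real \<Rightarrow> bool" where
  "lyapunov_stable g b \<longleftrightarrow>
     (\<forall>\<epsilon>>0. \<exists>d>0. \<forall>x. solves_ode01 g x \<and> \<bar>x 0 - b\<bar> < d \<longrightarrow> (\<forall>t\<ge>0. \<bar>x t - b\<bar> < \<epsilon>))"

definition locally_attractive :: "(real \<Rightarrow> real) \<Rightarrow> real \<Rightarrow> bool" where
  "locally_attractive g b \<longleftrightarrow>
     (\<exists>d>0. \<forall>x. solves_ode01 g x \<and> \<bar>x 0 - b\<bar> < d \<longrightarrow> (x \<longlongrightarrow> b) at_top)"

definition asymp_stable :: "(real \<Rightarrow> real) \<Rightarrow> real \<Rightarrow> bool" where
  "asymp_stable g b \<longleftrightarrow>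
     b \<in> {0..1} \<and> g b = 0 \<and> lyapunov_stable g b \<and> locally_attractive g b"

definition asymp_stable_set :: "(real \<Rightarrow> real) \<Rightarrow> real set" where
  "asymp_stable_set g = {b. asymp_stable g b}"

definition domain_of_attraction :: "(real \<Rightarrow> real) \<Rightarrow> real set \<Rightarrow> real set" where
  "domain_of_attraction g A =
     {b \<in> {0..1}. \<forall>x. solves_ode01 g x \<and> x 0 = b \<longrightarrow> ((\<lambda>t. infdist (x t) A) \<longlongrightarrow> 0) at_top}"

section \<open>The platform and its users\<close>

datatype actuality = Real_Post | Fake_Post

text \<open>The actions 0, 1, 2: do not participate; tag by innate ability; tag using the warning.\<close>

datatype action = Abstain | Innate | Assisted

type_synonym profile = "action \<Rightarrow> real"

text \<open>
  For each profile and each actuality, \<open>law\<close> is the probability space carrying the tagging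
  process; \<open>tag \<mu> u k\<close> tells whether the \<open>(k+1)\<close>-th tag is fake, and \<open>share \<mu> u k\<close> is
  $\beta_{u,k}$.
\<close>

record 'w platform =
  ability :: "actuality \<Rightarrow> real"                          (* alpha_u *)
  fake_rate :: real                                        (* p *)
  adv :: real                                              (* mu_a *)
  effort_cost :: real                                      (* C_e *)
  part_payoff :: real                                      (* Q_p *)
  abst_payoff :: real                                      (* Q_np *)
  target :: "actuality \<Rightarrow> real"                           (* theta (fake), delta (real) *)
  raw_response :: "real \<Rightarrow> real \<Rightarrow> real"                 (* h *)
  warning :: "real \<Rightarrow> real"                               (* omega *)
  law :: "profile \<Rightarrow> actuality \<Rightarrow> 'w measure"
  tag :: "profile \<Rightarrow> actuality \<Rightarrow> nat \<Rightarrow> 'w \<Rightarrow> bool"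
  share :: "profile \<Rightarrow> actuality \<Rightarrow> nat \<Rightarrow> 'w \<Rightarrow> real"

definition response :: "'w platform \<Rightarrow> real \<Rightarrow> real \<Rightarrow> real" where
  "response E a w = min (raw_response E a w) 1"

definition admissible :: "'w platform \<Rightarrow> bool" where
  "admissible E \<longleftrightarrow>
     0 < ability E Real_Post \<and> ability E Real_Post < ability E Fake_Post \<and>
     ability E Fake_Post < 1 \<and>
     0 < fake_rate E \<and> fake_rate E < 1 \<and>
     0 \<le> adv E \<and> adv E < 1 \<and>
     0 < effort_cost E \<and> 0 < part_payoff E \<and> abst_payoff E \<le> part_payoff E \<and>
     (\<forall>u. 0 < target E u \<and> target E u \<le> 1 \<and> ability E u < target E u) \<and>
     target E Real_Post < target E Fake_Post \<and>
     (\<forall>a\<in>{0..1}. \<forall>w\<ge>0. 0 \<le> response E a w) \<and>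
     (\<exists>L. L-lipschitz_on ({0..1} \<times> {0..}) (\<lambda>(a, w). raw_response E a w)) \<and>
     (\<forall>\<beta>\<in>{0..1}. 0 \<le> warning E \<beta>) \<and>
     (\<forall>u. \<exists>L. L-lipschitz_on {0..1} (\<lambda>\<beta>. response E (ability E u) (warning E \<beta>)))"

definition is_profile :: "'w platform \<Rightarrow> profile \<Rightarrow> bool" where
  "is_profile E \<mu> \<longleftrightarrow> (\<forall>s. 0 \<le> \<mu> s) \<and> \<mu> Abstain + \<mu> Innate + \<mu> Assisted = 1 - adv E"

definition eta :: "'w platform \<Rightarrow> profile \<Rightarrow> real" where
  "eta E \<mu> = \<mu> Innate / (\<mu> Innate + \<mu> Assisted + adv E)"

definition eta_adv :: "'w platform \<Rightarrow> profile \<Rightarrow> real" where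
  "eta_adv E \<mu> = adv E / (\<mu> Innate + \<mu> Assisted + adv E)"

definition target_adv :: "'w platform \<Rightarrow> profile \<Rightarrow> actuality \<Rightarrow> real" where
  "target_adv E \<mu> u = target E u * (1 - eta_adv E \<mu>)"

definition mu_line :: "'w platform \<Rightarrow> real \<Rightarrow> profile" where
  "mu_line E x s = (case s of Abstain \<Rightarrow> 0 | Innate \<Rightarrow> x | Assisted \<Rightarrow> 1 - x - adv E)"

section \<open>Tagging dynamics\<close>

definition fake_tag_prob :: "'w platform \<Rightarrow> profile \<Rightarrow> actuality \<Rightarrow> real \<Rightarrow> real" where
  "fake_tag_prob E \<mu> u \<beta> =
     ability E u * eta E \<mu> +
     (1 - eta E \<mu> - eta_adv E \<mu>) * response E (ability E u) (warning E \<beta>)"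

definition drift :: "'w platform \<Rightarrow> profile \<Rightarrow> actuality \<Rightarrow> real \<Rightarrow> real" where
  "drift E \<mu> u \<beta> = fake_tag_prob E \<mu> u \<beta> - \<beta>"

text \<open>
  The filtration \<open>F\<close> is the past.  The initial value \<open>share E \<mu> u 0\<close>, shown to the first
  tagger, is an arbitrary element of [0,1], possibly random; from the first tag on it no longer
  enters the proportion.
\<close>

definition tagging_process :: "'w platform \<Rightarrow> profile \<Rightarrow> actuality \<Rightarrow> bool" where
  "tagging_process E \<mu> u \<longleftrightarrow>
     prob_space (law E \<mu> u) \<and>
     (\<forall>w\<in>space (law E \<mu> u). share E \<mu> u 0 w \<in> {0..1}) \<and>
     (\<forall>k. \<forall>w\<in>space (law E \<mu> u).
        share E \<mu> u (Suc k) w =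
          share E \<mu> u k w + 1 / (real k + 1) * (of_bool (tag E \<mu> u k w) - share E \<mu> u k w)) \<and>
     (\<exists>F. filtration (space (law E \<mu> u)) F \<and>
        (\<forall>k. subalgebra (law E \<mu> u) (F k) \<and>
             share E \<mu> u k \<in> borel_measurable (F k) \<and>
             tag E \<mu> u k \<in> measurable (F (Suc k)) (count_space UNIV) \<and>
             (AE w in law E \<mu> u.
                real_cond_exp (law E \<mu> u) (F k) (\<lambda>w'. of_bool (tag E \<mu> u k w')) w =
                fake_tag_prob E \<mu> u (share E \<mu> u k w))))"

definition standing_assumption :: "'w platform \<Rightarrow> profile \<Rightarrow> actuality \<Rightarrow> bool" where
  "standing_assumption E \<mu> u \<longleftrightarrow>
     is_singleton (asymp_stable_set (drift E \<mu> u)) \<and>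
     (AE w in law E \<mu> u. \<exists>\<^sub>\<infinity>k. share E \<mu> u k w \<in>
        domain_of_attraction (drift E \<mu> u) (asymp_stable_set (drift E \<mu> u)))"

section \<open>Success probability and the game\<close>

text \<open>The detour through \<open>ereal\<close> is only because \<open>liminf\<close> needs a complete lattice.\<close>

definition liminf_fake :: "'w platform \<Rightarrow> profile \<Rightarrow> real" where
  "liminf_fake E \<mu> = real_of_ereal (liminf (\<lambda>k. ereal
     \<P>(w in law E \<mu> Fake_Post. share E \<mu> Fake_Post k w \<ge> target_adv E \<mu> Fake_Post)))"

definition liminf_real :: "'w platform \<Rightarrow> profile \<Rightarrow> real" where
  "liminf_real E \<mu> = real_of_ereal (liminf (\<lambda>k. ereal
     \<P>(w in law E \<mu> Real_Post. share E \<mu> Real_Post k w \<le> target_adv E \<mu> Real_Post)))"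

definition success_prob :: "'w platform \<Rightarrow> profile \<Rightarrow> real" where
  "success_prob E \<mu> =
     (if \<mu> Abstain < 1 - adv E
      then fake_rate E * liminf_fake E \<mu> + (1 - fake_rate E) * liminf_real E \<mu>
      else 0)"

text \<open>
  \<open>R\<close> is the reward and \<open>\<gamma>\<close> the weight of action 2.  The denominator vanishes only if there are
  no adversaries and nobody participates; the success probability, hence the reward term, is
  then 0.
\<close>

definition utility :: "'w platform \<Rightarrow> real \<Rightarrow> real \<Rightarrow> profile \<Rightarrow> action \<Rightarrow> real" where
  "utility E R \<gamma> \<mu> s = (case s of
     Abstain \<Rightarrow> abst_payoff E
   | Innate \<Rightarrow> part_payoff E +
       R * success_prob E \<mu> / (\<mu> Innate + adv E + \<gamma> * \<mu> Assisted)
   | Assisted \<Rightarrow> part_payoff E - effort_cost E +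
       \<gamma> * R * success_prob E \<mu> / (\<mu> Innate + adv E + \<gamma> * \<mu> Assisted))"

definition is_NE :: "'w platform \<Rightarrow> real \<Rightarrow> real \<Rightarrow> profile \<Rightarrow> bool" where
  "is_NE E R \<gamma> \<mu> \<longleftrightarrow>
     is_profile E \<mu> \<and>
     {s. \<mu> s > 0} \<subseteq> {s. is_arg_max (utility E R \<gamma> \<mu>) (\<lambda>_. True) s}"

text \<open>
  At the profile where nobody participates, the success event is declared to have probability 0
  and the tagging process is not constrained; such a profile is not an AI-NE.
\<close>

definition is_AI_NE :: "'w platform \<Rightarrow> real \<Rightarrow> real \<Rightarrow> profile \<Rightarrow> bool" where
  "is_AI_NE E R \<gamma> \<mu> \<longleftrightarrow>
     is_NE E R \<gamma> \<mu> \<and> \<mu> Abstain < 1 - adv E \<and> liminf_fake E \<mu> = 1 \<and> liminf_real E \<mu> = 1"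

definition is_AI_game :: "'w platform \<Rightarrow> real \<Rightarrow> real \<Rightarrow> bool" where
  "is_AI_game E R \<gamma> \<longleftrightarrow> (\<exists>\<mu>. is_AI_NE E R \<gamma> \<mu>)"

definition gamma_low :: "'w platform \<Rightarrow> real \<Rightarrow> real" where
  "gamma_low E x =
     1 / (1 - fake_rate E) *
     ((1 - (x + adv E) * (1 - fake_rate E)) / (1 - x - adv E))"

lemma drift_mu_line:
  "drift E (mu_line E x) u \<beta> =
     ability E u * x + (1 - x - adv E) * response E (ability E u) (warning E \<beta>) - \<beta>"
  by (simp add: drift_def fake_tag_prob_def eta_def eta_adv_def mu_line_def)

end

theory Submission
  imports Defs
begin

text \<open>
  Everything rests on one inequality: the drift \<open>g\<close> satisfies
  \<open>(x - b) * g x \<le> - c * (x - b)\<^sup>2\<close> on the unit interval for some \<open>c > 0\<close>. It holds at the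
  profile \<open>\<mu>\<^sub>\<eta>\<close> because \<open>g\<close> points inwards at both ends and vanishes only at \<open>b\<close>, so it is
  positive to the left of \<open>b\<close> and negative to the right; together with the negative derivative at
  \<open>b\<close> this makes the difference quotient \<open>g x / (x - b)\<close> a continuous negative function, and
  compactness bounds it away from 0 (\<open>restoring_if_unique_stable_zero\<close>).

  The inequality makes the squared distance to \<open>b\<close> a Lyapunov function twice over. Along the ODE
  it decays exponentially, which gives stability and global attraction
  (\<open>restoring_asymp_stable\<close>). Along the tagging process its mean \<open>a\<close> obeys
  \<open>a (k + 1) \<le> (1 - 2 c / (k + 1)) a k + 1 / (k + 1)\<^sup>2\<close>, and divergence of the harmonic
  series forces \<open>a\<close> to 0. The proportion of fake tags thus converges to \<open>b\<close> in mean square, hence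
  in probability, which already decides the lower limits of the success probabilities as soon as
  the target differs from \<open>b\<close> (\<open>tagging_process_threshold_limits\<close>).

  The game is then a comparison of utilities. Assisted and innate tagging pay the same exactly when
  \<open>(\<gamma> - 1) R P = C\<^sub>e D\<close>, with \<open>P\<close> the success probability and \<open>D\<close> the reward denominator; the
  given \<open>R\<close> solves this at \<open>\<mu>\<^sub>\<eta>\<close> with \<open>P = 1\<close>. For \<open>x < \<eta>\<close> the denominator is larger while
  \<open>P \<le> 1\<close>, so assistance does not pay. Where no one uses the warning, the drift is affine and the
  limits fall short of both targets, so only real posts are identified and \<open>P = 1 - p\<close>
  (\<open>success_prob_unassisted\<close>); for \<open>x = 1 - \<mu>\<^sub>a\<close> the lower bound on \<open>\<gamma>\<close> says precisely that
  assistance is then profitable.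

  If abstaining is optimal at a profile in which somebody participates, the reward term is at most
  0. Then assistance costs more than it brings, so no one uses the warning; but then
  \<open>P = 1 - p > 0\<close> and the reward term is positive, a contradiction
  (\<open>not_NE_if_abstaining\<close>).
\<close>

section \<open>Drifts that pull towards a point\<close>

definition restoring :: "(real \<Rightarrow> real) \<Rightarrow> real \<Rightarrow> real \<Rightarrow> bool" where
  "restoring g b c \<longleftrightarrow> (\<forall>x\<in>{0..1}. (x - b) * g x \<le> - c * (x - b)\<^sup>2)"

text \<open>
  The slope \<open>D\<close> is what fills the gap in the difference quotient at \<open>b\<close>, so that its maximum over
  the unit interval is attained and negative.
\<close>

lemma restoring_if_unique_stable_zero:
  fixes g :: "real \<Rightarrow> real"
  assumes cont: "continuous_on {0..1} g" and ends: "0 \<le> g 0" "g 1 \<le> 0"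
    and b: "b \<in> {0..1}" "g b = 0"
    and unique: "\<And>x. x \<in> {0..1} \<Longrightarrow> g x = 0 \<Longrightarrow> x = b"
    and deriv: "(g has_real_derivative D) (at b within {0..1})" and "D < 0"
  obtains c where "0 < c" "restoring g b c"
proof -
  define q where "q x = (if x = b then D else g x / (x - b))" for x
  \<comment> \<open>A wrong sign on either side of \<open>b\<close> would give a second zero between there and the endpoint.\<close>
  have pos: "0 < g x" if x: "0 \<le> x" "x < b" for x
  proof (rule ccontr)
    assume "\<not> 0 < g x"
    then obtain y where "0 \<le> y" "y \<le> x" "g y = 0"
      using IVT2'[of g x 0 0] ends continuous_on_subset[OF cont, of "{0..x}"] x b by auto
    then show False using unique[of y] x b by auto
  qed
  have neg: "g x < 0" if x: "b < x" "x \<le> 1" for x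
  proof (rule ccontr)
    assume "\<not> g x < 0"
    then obtain y where "x \<le> y" "y \<le> 1" "g y = 0"
      using IVT2'[of g 1 0 x] ends continuous_on_subset[OF cont, of "{x..1}"] x b by auto
    then show False using unique[of y] x b by auto
  qed
  have q_neg: "q x < 0" if "x \<in> {0..1}" for x
    using pos[of x] neg[of x] that \<open>D < 0\<close>
    by (cases x b rule: linorder_cases) (auto simp: q_def divide_pos_neg divide_neg_pos)
  have "continuous_on {0..1} q"
    unfolding continuous_on_def
  proof
    fix x :: real assume x: "x \<in> {0..1}"
    show "(q \<longlongrightarrow> q x) (at x within {0..1})"
    proof (cases "x = b")
      case True
      have "((\<lambda>y. (g y - g b) / (y - b)) \<longlongrightarrow> D) (at b within {0..1})"
        using deriv by (simp add: has_field_derivative_iff)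
      moreover have "\<forall>\<^sub>F y in at b within {0..1}. (g y - g b) / (y - b) = q y"
        by (auto simp: eventually_at_filter q_def b)
      ultimately show ?thesis
        using True by (auto simp: q_def intro: Lim_transform_eventually)
    next
      case False
      have "((\<lambda>y. g y / (y - b)) \<longlongrightarrow> g x / (x - b)) (at x within {0..1})"
        using cont x False by (auto intro!: tendsto_intros simp: continuous_on_def)
      moreover have "\<forall>\<^sub>F y in at x within {0..1}. y \<noteq> b"
        using False by (intro tendsto_imp_eventually_ne[OF tendsto_ident_at])
      then have "\<forall>\<^sub>F y in at x within {0..1}. g y / (y - b) = q y"
        by eventually_elim (simp add: q_def)
      ultimately show ?thesis
        using False by (auto simp: q_def intro: Lim_transform_eventually)
    qed
  qed
  then obtain m where m: "m \<in> {0..1}" "\<And>x. x \<in> {0..1} \<Longrightarrow> q x \<le> q m"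
    using continuous_attains_sup[of "{0..1::real}" q] by auto
  have "restoring g b (- q m)"
    unfolding restoring_def
  proof
    fix x :: real assume x: "x \<in> {0..1}"
    have "(x - b) * g x = q x * (x - b)\<^sup>2"
      by (cases "x = b") (auto simp: q_def power2_eq_square)
    also have "\<dots> \<le> q m * (x - b)\<^sup>2"
      using m x by (intro mult_right_mono) auto
    finally show "(x - b) * g x \<le> - (- q m) * (x - b)\<^sup>2" by simp
  qed
  then show thesis using q_neg[OF m(1)] by (intro that[of "- q m"]) simp_all
qed

text \<open>
  Multiplying the squared distance by \<open>exp (2 c t)\<close> absorbs the decay rate, so that the product is
  nonincreasing.
\<close>

lemma solves_ode01_exponential_decay:
  assumes sol: "solves_ode01 g x" and g: "restoring g b c" and "0 \<le> t"
  shows "\<bar>x t - b\<bar> \<le> \<bar>x 0 - b\<bar> * exp (- c * t)"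
proof -
  define W where "W s = exp (2 * c * s) * (x s - b)\<^sup>2" for s
  define W' where "W' s = 2 * exp (2 * c * s) * (c * (x s - b)\<^sup>2 + (x s - b) * g (x s))" for s
  have x: "x s \<in> {0..1}" "(x has_real_derivative g (x s)) (at s within {0..})" if "0 \<le> s" for s
    using sol that by (auto simp: solves_ode01_def)
  have dW: "(W has_real_derivative W' s) (at s within {0..})" if "0 \<le> s" for s
    unfolding W_def[abs_def] W'_def
    by (rule derivative_eq_intros x that refl)+ (simp add: algebra_simps power2_eq_square)
  have "W t \<le> W 0"
  proof (rule DERIV_nonpos_imp_decreasing_open[OF \<open>0 \<le> t\<close>])
    fix s assume s: "0 < s" "s < t"
    \<comment> \<open>Solutions have one-sided derivatives only at time 0; inside, these are ordinary ones.\<close>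
    have "at s within {0..} = at s"
      using s by (intro at_within_interior) (simp add: interior_real_atLeast)
    moreover have "W' s \<le> 0"
    proof -
      have "(x s - b) * g (x s) \<le> - c * (x s - b)\<^sup>2"
        using g x(1)[of s] s by (simp add: restoring_def)
      then show ?thesis by (simp add: W'_def mult_le_0_iff)
    qed
    ultimately show "\<exists>y. DERIV W s :> y \<and> y \<le> 0" using dW[of s] s by auto
  next
    have "continuous_on {0..} W" using dW by (auto intro: DERIV_continuous_on)
    then show "continuous_on {0..t} W" by (rule continuous_on_subset) auto
  qed
  then have "(exp (c * t) * \<bar>x t - b\<bar>)\<^sup>2 \<le> \<bar>x 0 - b\<bar>\<^sup>2"
    by (simp add: W_def power_mult_distrib exp_double mult.assoc)
  then have "exp (c * t) * \<bar>x t - b\<bar> \<le> \<bar>x 0 - b\<bar>"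
    by (rule power2_le_imp_le) simp
  then show ?thesis by (simp add: exp_minus field_simps)
qed

lemma restoring_tendsto:
  assumes sol: "solves_ode01 g x" and g: "restoring g b c" and "0 < c"
  shows "(x \<longlongrightarrow> b) at_top"
proof -
  have "((\<lambda>t. \<bar>x 0 - b\<bar> * exp (- c * t)) \<longlongrightarrow> 0) at_top"
    using \<open>0 < c\<close> by real_asymp
  moreover have "\<forall>\<^sub>F t in at_top. norm (x t - b) \<le> \<bar>x 0 - b\<bar> * exp (- c * t)"
    using eventually_ge_at_top[of 0]
    by eventually_elim (use solves_ode01_exponential_decay[OF sol g] in simp)
  ultimately have "((\<lambda>t. x t - b) \<longlongrightarrow> 0) at_top"
    by (rule Lim_null_comparison[rotated])
  then show ?thesis by (rule LIM_zero_cancel)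
qed

lemma restoring_asymp_stable:
  assumes g: "restoring g b c" and "0 < c" and b: "b \<in> {0..1}" "g b = 0"
  shows "asymp_stable g b" "domain_of_attraction g {b} = {0..1}"
proof -
  have "\<bar>x t - b\<bar> < \<epsilon>" if "solves_ode01 g x" "\<bar>x 0 - b\<bar> < \<epsilon>" "0 \<le> t" for x t \<epsilon>
  proof -
    have "\<bar>x t - b\<bar> \<le> \<bar>x 0 - b\<bar> * exp (- c * t)"
      by (rule solves_ode01_exponential_decay[OF that(1) g that(3)])
    also have "\<dots> \<le> \<bar>x 0 - b\<bar>" using \<open>0 < c\<close> that(3) by (intro mult_left_le) auto
    finally show ?thesis using that(2) by simp
  qed
  then have "lyapunov_stable g b" unfolding lyapunov_stable_def by blast
  moreover have "locally_attractive g b"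
    unfolding locally_attractive_def
    using restoring_tendsto[OF _ g \<open>0 < c\<close>] by (intro exI[of _ 1]) auto
  ultimately show "asymp_stable g b" using b by (simp add: asymp_stable_def)
  have "((\<lambda>t. infdist (x t) {b}) \<longlongrightarrow> 0) at_top" if "solves_ode01 g x" for x
    using tendsto_dist[OF restoring_tendsto[OF that g \<open>0 < c\<close>] tendsto_const[of b]] by simp
  then show "domain_of_attraction g {b} = {0..1}"
    by (auto simp: domain_of_attraction_def)
qed

section \<open>Mean-square convergence of the tagging process\<close>

text \<open>
  Adding the tail bound \<open>1 / k\<close> for the sum of the remaining \<open>1 / j\<^sup>2\<close> turns \<open>a\<close> into a
  nonincreasing sequence, whose total decrease dominates the sum of \<open>d a k / (k + 1)\<close>. That sum is
  therefore finite, and a positive limit would contradict the divergence of the harmonic series.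
\<close>

lemma decay_recursion_tendsto_0:
  fixes a :: "nat \<Rightarrow> real"
  assumes nonneg: "\<And>k. 0 \<le> a k" and "0 < d"
    and rec: "\<And>k. a (Suc k) \<le> (1 - d / (real k + 1)) * a k + 1 / (real k + 1)\<^sup>2"
  shows "a \<longlonglongrightarrow> 0"
proof -
  define w where "w k = a (Suc k) + 1 / (real k + 1)" for k
  have step: "w (Suc k) \<le> w k - d * (a (Suc k) / (real k + 2))" for k
  proof -
    have "1 / (real k + 2)\<^sup>2 \<le> 1 / ((real k + 1) * (real k + 2))"
      unfolding power2_eq_square by (intro divide_left_mono mult_right_mono) auto
    also have "\<dots> = 1 / (real k + 1) - 1 / (real k + 2)"
      by (simp add: divide_simps)
    finally show ?thesis
      using rec[of "Suc k"] by (simp add: w_def algebra_simps)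
  qed
  have w_nonneg: "0 \<le> w k" for k using nonneg by (simp add: w_def)
  have "decseq w"
  proof (rule decseq_SucI)
    fix k show "w (Suc k) \<le> w k"
      using step[of k] nonneg[of "Suc k"] \<open>0 < d\<close>
      by (smt (verit) divide_nonneg_nonneg mult_nonneg_nonneg of_nat_0_le_iff)
  qed
  then obtain L where L: "w \<longlonglongrightarrow> L" "\<And>k. L \<le> w k"
    using decseq_convergent[of w 0] w_nonneg by blast
  have lim: "(\<lambda>k. a (Suc k)) \<longlonglongrightarrow> L"
  proof -
    have "(\<lambda>k. 1 / (real k + 1)) \<longlonglongrightarrow> 0" by real_asymp
    from tendsto_diff[OF L(1) this] show ?thesis by (simp add: w_def)
  qed
  then have "0 \<le> L" using nonneg by (intro LIMSEQ_le_const) auto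
  moreover have "\<not> 0 < L"
  proof
    assume "0 < L"
    have partial: "d * (\<Sum>k<n. a (Suc k) / (real k + 2)) \<le> w 0 - w n" for n
    proof (induction n)
      case (Suc n) then show ?case using step[of n] by (simp add: distrib_left)
    qed simp
    have summable: "summable (\<lambda>k. a (Suc k) / (real k + 2))"
    proof (rule summableI_nonneg_bounded)
      fix n show "(\<Sum>k<n. a (Suc k) / (real k + 2)) \<le> w 0 / d"
        using partial[of n] w_nonneg[of n] \<open>0 < d\<close> by (simp add: field_simps)
    qed (use nonneg in auto)
    have "\<forall>\<^sub>F k in sequentially. L / 2 < a (Suc k)"
      using order_tendstoD(1)[OF lim, of "L / 2"] \<open>0 < L\<close> by simp
    then have dominated: "\<forall>\<^sub>F k in sequentially. norm (inverse (real (k + 2)))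
        \<le> 2 / L * (a (Suc k) / (real k + 2))"
    proof eventually_elim
      case (elim k)
      then have "1 \<le> 2 / L * a (Suc k)" using \<open>0 < L\<close> by (simp add: field_simps)
      from divide_right_mono[OF this, of "real k + 2"] show ?case
        by (simp add: inverse_eq_divide add.commute)
    qed
    have "summable (\<lambda>k. inverse (real (k + 2)))"
      by (rule summable_comparison_test_ev[OF dominated summable_mult[OF summable]])
    then show False
      using not_summable_harmonic[where 'a = real] summable_iff_shift[of "\<lambda>k. inverse (real k)" 2]
      by simp
  qed
  ultimately have "L = 0" by simp
  then show ?thesis using lim LIMSEQ_imp_Suc by blast
qed

lemma tagging_process_share_in_unit_interval:
  assumes proc: "tagging_process E \<mu> u" and w: "w \<in> space (law E \<mu> u)"
  shows "share E \<mu> u k w \<in> {0..1}"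
proof (induction k)
  case 0 then show ?case using proc w by (auto simp: tagging_process_def)
next
  case (Suc k)
  define s and e and T :: real
    where "s = share E \<mu> u k w" and "e = 1 / (real k + 1)" and "T = of_bool (tag E \<mu> u k w)"
  have "share E \<mu> u (Suc k) w = (1 - e) * s + e * T"
    using proc w by (auto simp: tagging_process_def s_def e_def T_def algebra_simps)
  moreover have "(1 - e) *\<^sub>R s + e *\<^sub>R T \<in> {0..1}"
    using Suc by (intro convexD convex_real_interval) (auto simp: s_def e_def T_def)
  ultimately show ?case by simp
qed

text \<open>
  Expanding the square, only the cross term \<open>(s - b) T\<close> with the new tag \<open>T\<close> needs care. Given the
  past, \<open>T\<close> has mean \<open>s\<close> plus the drift, and the restoring inequality bounds the
  product of \<open>s - b\<close> with the drift.
\<close>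

lemma tagging_process_second_moment_step:
  assumes proc: "tagging_process E \<mu> u" and g: "restoring (drift E \<mu> u) b c" and b: "b \<in> {0..1}"
  defines "A k \<equiv> (\<integral>w. (share E \<mu> u k w - b)\<^sup>2 \<partial>law E \<mu> u)"
  shows "A (Suc k) \<le> (1 - 2 * c / (real k + 1)) * A k + 1 / (real k + 1)\<^sup>2"
proof -
  define M where "M = law E \<mu> u"
  define s where "s = share E \<mu> u k"
  define T :: "_ \<Rightarrow> real" where "T w = of_bool (tag E \<mu> u k w)" for w
  define e where "e = 1 / (real k + 1)"
  from proc have "prob_space M" by (simp add: tagging_process_def M_def)
  then interpret prob_space M .
  from proc obtain F where sub: "subalgebra M (F j)"
    and meas: "share E \<mu> u j \<in> borel_measurable (F j)"
      "tag E \<mu> u j \<in> measurable (F (Suc j)) (count_space UNIV)"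
    and cond: "AE w in M. real_cond_exp M (F j) (\<lambda>w'. of_bool (tag E \<mu> u j w')) w =
        fake_tag_prob E \<mu> u (share E \<mu> u j w)" for j
    unfolding tagging_process_def M_def by blast
  interpret finite_measure_subalgebra M "F k"
    using sub by unfold_locales
  have s_F: "s \<in> borel_measurable (F k)" using meas by (simp add: s_def)
  then have s_M [measurable]: "s \<in> borel_measurable M"
    using measurable_from_subalg[OF sub] by blast
  have "tag E \<mu> u k \<in> measurable M (count_space UNIV)"
    using measurable_from_subalg[OF sub] meas by blast
  then have T_M [measurable]: "T \<in> borel_measurable M"
    unfolding T_def[abs_def] by measurable
  have s_bd: "s w \<in> {0..1}" if "w \<in> space M" for w
    using tagging_process_share_in_unit_interval[OF proc] that by (simp add: s_def M_def)
  have T_bd: "T w \<in> {0..1}" for w by (simp add: T_def)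
  have diff_bd: "\<bar>x - y\<bar> \<le> 1" if "x \<in> {0..1}" "y \<in> {0..1}" for x y :: real
    using that by auto
  have sq_bd: "(x - y)\<^sup>2 \<le> 1" if "x \<in> {0..1}" "y \<in> {0..1}" for x y :: real
    using diff_bd[OF that] by (simp add: abs_square_le_1)
  have int_sq: "integrable M (\<lambda>w. (s w - b)\<^sup>2)" "integrable M (\<lambda>w. (T w - s w)\<^sup>2)"
    using sq_bd s_bd T_bd b by (auto intro!: integrable_const_bound[of _ 1] AE_I2)
  have prod_bd: "norm ((s w - b) * y) \<le> 1" if "w \<in> space M" "y \<in> {0..1}" for w y
  proof -
    have "\<bar>s w - b\<bar> * \<bar>y\<bar> \<le> 1 * 1"
      using diff_bd[OF s_bd[OF that(1)] b] that(2) by (intro mult_mono) auto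
    then show ?thesis by (simp add: abs_mult)
  qed
  have int_T: "integrable M (\<lambda>w. (s w - b) * T w)"
    by (intro integrable_const_bound[of _ 1] AE_I2 prod_bd T_bd) measurable
  have int_s: "integrable M (\<lambda>w. (s w - b) * s w)"
    by (intro integrable_const_bound[of _ 1] AE_I2 prod_bd s_bd) measurable
  have cross: "(\<integral>w. (s w - b) * T w \<partial>M) \<le> (\<integral>w. (s w - b) * s w - c * (s w - b)\<^sup>2 \<partial>M)"
  proof -
    have sb_F: "(\<lambda>w. s w - b) \<in> borel_measurable (F k)" using s_F by measurable
    note intg = real_cond_exp_intg[OF int_T sb_F T_M]
    have "AE w in M. (s w - b) * real_cond_exp M (F k) T w
        \<le> (s w - b) * s w - c * (s w - b)\<^sup>2"
    proof -
      from cond[of k] have "AE w in M. real_cond_exp M (F k) T w = fake_tag_prob E \<mu> u (s w)"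
        by (simp add: T_def[abs_def] s_def)
      then show ?thesis
        using AE_space
      proof eventually_elim
        case (elim w)
        have "(s w - b) * (fake_tag_prob E \<mu> u (s w) - s w) \<le> - c * (s w - b)\<^sup>2"
          using g s_bd[OF elim(2)] by (simp add: restoring_def drift_def)
        then show ?case using elim(1) by (simp add: algebra_simps)
      qed
    qed
    then have "(\<integral>w. (s w - b) * real_cond_exp M (F k) T w \<partial>M)
        \<le> (\<integral>w. (s w - b) * s w - c * (s w - b)\<^sup>2 \<partial>M)"
      using intg(1) int_s int_sq(1) by (intro integral_mono_AE) simp_all
    then show ?thesis using intg(2) by simp
  qed
  have "A (Suc k) = (\<integral>w. (s w - b)\<^sup>2 + 2 * e * ((s w - b) * T w) - 2 * e * ((s w - b) * s w)
      + e\<^sup>2 * (T w - s w)\<^sup>2 \<partial>M)"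
    unfolding A_def M_def[symmetric]
  proof (rule Bochner_Integration.integral_cong[OF refl])
    fix w assume "w \<in> space M"
    then have step: "share E \<mu> u (Suc k) w = s w + e * (T w - s w)"
      using proc by (auto simp: tagging_process_def s_def e_def T_def M_def)
    then show "(share E \<mu> u (Suc k) w - b)\<^sup>2 = (s w - b)\<^sup>2 + 2 * e * ((s w - b) * T w)
        - 2 * e * ((s w - b) * s w) + e\<^sup>2 * (T w - s w)\<^sup>2"
      unfolding step by (simp add: algebra_simps power2_eq_square)
  qed
  also have "\<dots> = (\<integral>w. (s w - b)\<^sup>2 \<partial>M) + 2 * e * (\<integral>w. (s w - b) * T w \<partial>M)
      - 2 * e * (\<integral>w. (s w - b) * s w \<partial>M) + e\<^sup>2 * (\<integral>w. (T w - s w)\<^sup>2 \<partial>M)"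
    using int_sq int_T int_s by simp
  also have "\<dots> \<le> A k - 2 * e * c * A k + e\<^sup>2"
  proof -
    have "(\<integral>w. (T w - s w)\<^sup>2 \<partial>M) \<le> (\<integral>w. 1 \<partial>M)"
      using int_sq(2) sq_bd s_bd T_bd by (intro integral_mono) auto
    then have "e\<^sup>2 * (\<integral>w. (T w - s w)\<^sup>2 \<partial>M) \<le> e\<^sup>2"
      by (simp add: mult_left_le prob_space)
    moreover have "(\<integral>w. (s w - b) * T w \<partial>M) \<le> (\<integral>w. (s w - b) * s w \<partial>M) - c * A k"
      using cross int_s int_sq(1) by (simp add: A_def s_def M_def)
    then have "2 * e * (\<integral>w. (s w - b) * T w \<partial>M)
        \<le> 2 * e * ((\<integral>w. (s w - b) * s w \<partial>M) - c * A k)"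
      by (intro mult_left_mono) (auto simp: e_def)
    ultimately show ?thesis
      by (simp add: A_def s_def M_def algebra_simps)
  qed
  finally show ?thesis by (simp add: e_def left_diff_distrib power_one_over)
qed

lemma tagging_process_share_measurable:
  assumes "tagging_process E \<mu> u"
  shows "share E \<mu> u k \<in> borel_measurable (law E \<mu> u)"
proof -
  obtain F where "subalgebra (law E \<mu> u) (F k)" "share E \<mu> u k \<in> borel_measurable (F k)"
    using assms unfolding tagging_process_def by blast
  then show ?thesis by (rule measurable_from_subalg)
qed

lemma tagging_process_concentrates:
  assumes proc: "tagging_process E \<mu> u" and g: "restoring (drift E \<mu> u) b c" and "0 < c"
    and b: "b \<in> {0..1}" and "0 < e"
  shows "(\<lambda>k. \<P>(w in law E \<mu> u. e \<le> \<bar>share E \<mu> u k w - b\<bar>)) \<longlonglongrightarrow> 0"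
proof -
  define A where "A k = (\<integral>w. (share E \<mu> u k w - b)\<^sup>2 \<partial>law E \<mu> u)" for k
  interpret prob_space "law E \<mu> u" using proc by (simp add: tagging_process_def)
  note [measurable] = tagging_process_share_measurable[OF proc]
  have "A \<longlonglongrightarrow> 0"
  proof (rule decay_recursion_tendsto_0[of A "2 * c"])
    show "A (Suc k) \<le> (1 - 2 * c / (real k + 1)) * A k + 1 / (real k + 1)\<^sup>2" for k
      unfolding A_def by (rule tagging_process_second_moment_step[OF proc g b])
  qed (use \<open>0 < c\<close> in \<open>simp_all add: A_def\<close>)
  then have lim: "(\<lambda>k. A k / e\<^sup>2) \<longlonglongrightarrow> 0"
    by (rule tendsto_divide_zero)
  have "\<P>(w in law E \<mu> u. e \<le> \<bar>share E \<mu> u k w - b\<bar>) \<le> A k / e\<^sup>2" for k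
    unfolding A_def
  proof (rule second_moment_method)
    have "\<bar>share E \<mu> u k w - b\<bar> \<le> 1" if "w \<in> space (law E \<mu> u)" for w
      using tagging_process_share_in_unit_interval[OF proc that, of k] b by auto
    then show "integrable (law E \<mu> u) (\<lambda>w. (share E \<mu> u k w - b)\<^sup>2)"
      by (intro integrable_const_bound[of _ 1] AE_I2) (auto simp: abs_square_le_1)
  qed (use \<open>0 < e\<close> in simp_all)
  then show ?thesis by (intro tendsto_sandwich[OF _ _ tendsto_const lim] always_eventually) simp_all
qed

text \<open>
  The threshold must differ from the limit \<open>b\<close>: convergence in probability says nothing about the
  side of \<open>b\<close> on which the proportion lies.
\<close>

lemma tagging_process_threshold_limits:
  assumes proc: "tagging_process E \<mu> u" and g: "restoring (drift E \<mu> u) b c" and "0 < c"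
    and b: "b \<in> {0..1}"
  shows "t < b \<Longrightarrow> (\<lambda>k. \<P>(w in law E \<mu> u. t \<le> share E \<mu> u k w)) \<longlonglongrightarrow> 1"
    and "b < t \<Longrightarrow> (\<lambda>k. \<P>(w in law E \<mu> u. t \<le> share E \<mu> u k w)) \<longlonglongrightarrow> 0"
    and "b < t \<Longrightarrow> (\<lambda>k. \<P>(w in law E \<mu> u. share E \<mu> u k w \<le> t)) \<longlonglongrightarrow> 1"
proof -
  interpret prob_space "law E \<mu> u" using proc by (simp add: tagging_process_def)
  note [measurable] = tagging_process_share_measurable[OF proc]
  let ?far = "\<lambda>e k. \<P>(w in law E \<mu> u. e \<le> \<bar>share E \<mu> u k w - b\<bar>)"
  have near_1: "(\<lambda>k. \<P>(w in law E \<mu> u. P (share E \<mu> u k w))) \<longlonglongrightarrow> 1"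
    if "0 < e" and P: "\<And>x. \<bar>x - b\<bar> < e \<Longrightarrow> P x" and [measurable]: "Measurable.pred borel P"
    for e and P :: "real \<Rightarrow> bool"
  proof (rule tendsto_sandwich[OF _ _ _ tendsto_const])
    have "1 - ?far e k \<le> \<P>(w in law E \<mu> u. P (share E \<mu> u k w))" for k
    proof -
      have "1 - ?far e k = \<P>(w in law E \<mu> u. \<not> e \<le> \<bar>share E \<mu> u k w - b\<bar>)"
        by (subst prob_neg) auto
      also have "\<dots> \<le> \<P>(w in law E \<mu> u. P (share E \<mu> u k w))"
        using P by (intro finite_measure_mono) auto
      finally show ?thesis .
    qed
    then show "\<forall>\<^sub>F k in sequentially. 1 - ?far e k \<le> \<P>(w in law E \<mu> u. P (share E \<mu> u k w))"
      by simp
    show "(\<lambda>k. 1 - ?far e k) \<longlonglongrightarrow> 1"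
      using tendsto_diff[OF tendsto_const
          tagging_process_concentrates[OF proc g \<open>0 < c\<close> b \<open>0 < e\<close>], of 1] by simp
  qed simp
  show "(\<lambda>k. \<P>(w in law E \<mu> u. t \<le> share E \<mu> u k w)) \<longlonglongrightarrow> 1" if "t < b"
    using that by (intro near_1[of "b - t"]) auto
  show "(\<lambda>k. \<P>(w in law E \<mu> u. share E \<mu> u k w \<le> t)) \<longlonglongrightarrow> 1" if "b < t"
    using that by (intro near_1[of "t - b"]) auto
  show "(\<lambda>k. \<P>(w in law E \<mu> u. t \<le> share E \<mu> u k w)) \<longlonglongrightarrow> 0" if "b < t"
  proof (rule tendsto_sandwich[OF _ _ tendsto_const])
    show "?far (t - b) \<longlonglongrightarrow> 0"
      using that by (intro tagging_process_concentrates[OF proc g \<open>0 < c\<close> b]) simp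
    show "\<forall>\<^sub>F k in sequentially. \<P>(w in law E \<mu> u. t \<le> share E \<mu> u k w) \<le> ?far (t - b) k"
      by (intro always_eventually allI finite_measure_mono) auto
  qed simp
qed

section \<open>Success probabilities\<close>

lemma real_liminf_eq_limit:
  assumes "f \<longlonglongrightarrow> l"
  shows "real_of_ereal (liminf (\<lambda>k. ereal (f k))) = l"
proof -
  have "liminf (\<lambda>k. ereal (f k)) = ereal l"
    using assms by (intro lim_imp_Liminf) simp_all
  then show ?thesis by simp
qed

text \<open>
  \<open>0 \<le> B\<close> covers sequences unbounded below, whose lower limit becomes 0 as a real.
\<close>

lemma real_liminf_le:
  assumes "\<And>k. f k \<le> B" "0 \<le> B"
  shows "real_of_ereal (liminf (\<lambda>k. ereal (f k))) \<le> B"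
proof -
  have "liminf (\<lambda>k. ereal (f k)) \<le> ereal B"
    using assms by (intro Liminf_le always_eventually) simp_all
  then show ?thesis using \<open>0 \<le> B\<close> by (cases "liminf (\<lambda>k. ereal (f k))") auto
qed

lemma success_prob_le_1:
  assumes "admissible E" and "\<mu> Abstain < 1 - adv E" and "\<And>u. tagging_process E \<mu> u"
  shows "success_prob E \<mu> \<le> 1"
proof -
  have "liminf_fake E \<mu> \<le> 1" "liminf_real E \<mu> \<le> 1"
    unfolding liminf_fake_def liminf_real_def
    using assms(3) by (auto intro!: real_liminf_le prob_space.prob_le_1 simp: tagging_process_def)
  then have "fake_rate E * liminf_fake E \<mu> + (1 - fake_rate E) * liminf_real E \<mu> \<le> 1"
    using assms(1) by (intro convex_bound_le) (auto simp: admissible_def)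
  then show ?thesis using assms(2) by (simp add: success_prob_def)
qed

text \<open>
  Without assistance the drift is \<open>b - x\<close> with \<open>b = \<alpha>\<^sub>u \<eta>(\<mu>)\<close>, and the target is the original
  level scaled by the same factor \<open>\<eta>(\<mu>)\<close>. Since the ability is below the level for either
  kind of post, the limit lies below both targets: real posts are recognised, fake ones are not.
\<close>

lemma success_prob_unassisted:
  assumes adm: "admissible E" and prof: "is_profile E \<mu>"
    and "\<mu> Assisted = 0" "\<mu> Abstain < 1 - adv E" and proc: "\<And>u. tagging_process E \<mu> u"
  shows "success_prob E \<mu> = 1 - fake_rate E"
proof -
  define b where "b u = ability E u * eta E \<mu>" for u
  have innate: "0 < \<mu> Innate" and adv: "0 \<le> adv E"
    using assms by (auto simp: is_profile_def admissible_def)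
  then have shares: "1 - eta_adv E \<mu> = eta E \<mu>" "0 < eta E \<mu>" "eta E \<mu> \<le> 1"
    using \<open>\<mu> Assisted = 0\<close> by (simp_all add: eta_def eta_adv_def field_simps)
  have ability: "0 < ability E u" "ability E u < 1" "ability E u < target E u" for u
    using adm by (cases u; auto simp: admissible_def)+
  have b: "b u \<in> {0..1}" "b u < target_adv E \<mu> u" for u
    using ability[of u] shares by (auto simp: b_def target_adv_def intro: mult_le_one)
  have "drift E \<mu> u x = b u - x" for u x
    using shares(1) by (simp add: drift_def fake_tag_prob_def b_def)
  then have "restoring (drift E \<mu> u) (b u) 1" for u
    unfolding restoring_def by (simp add: power2_eq_square) (simp add: algebra_simps)
  note limits = tagging_process_threshold_limits[OF proc this zero_less_one b(1)]
  have "liminf_fake E \<mu> = 0" "liminf_real E \<mu> = 1"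
    unfolding liminf_fake_def liminf_real_def
    by (intro real_liminf_eq_limit limits b(2))+
  then show ?thesis using \<open>\<mu> Abstain < 1 - adv E\<close> by (simp add: success_prob_def)
qed

section \<open>The game\<close>

lemma utility_gap:
  "utility E R \<gamma> \<mu> Assisted - utility E R \<gamma> \<mu> Innate =
     (\<gamma> - 1) * R * success_prob E \<mu> / (\<mu> Innate + adv E + \<gamma> * \<mu> Assisted) - effort_cost E"
  by (simp add: utility_def left_diff_distrib diff_divide_distrib)

lemma is_NE_best_response:
  "is_NE E R \<gamma> \<mu> \<Longrightarrow> 0 < \<mu> s \<Longrightarrow> utility E R \<gamma> \<mu> s' \<le> utility E R \<gamma> \<mu> s"
  by (auto simp: is_NE_def is_arg_max_linorder)

text \<open>
  Abstaining competes with innate tagging, which pays at least as much before the reward; so it can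
  be optimal only if the reward is not positive. Nobody then pays for assistance, and among users
  who tag by innate ability alone the reward is positive, because real posts are still identified.
\<close>

lemma not_NE_if_abstaining:
  assumes adm: "admissible E" and prof: "is_profile E \<mu>" and abst: "0 < \<mu> Abstain"
    and proc: "\<mu> Abstain < 1 - adv E \<Longrightarrow> (\<And>u. tagging_process E \<mu> u)"
    and some: "\<mu> Abstain < 1 - adv E \<or> abst_payoff E < part_payoff E"
    and "1 < \<gamma>" "0 < R"
  shows "\<not> is_NE E R \<gamma> \<mu>"
proof
  assume NE: "is_NE E R \<gamma> \<mu>"
  define D where "D = \<mu> Innate + adv E + \<gamma> * \<mu> Assisted"
  have le: "utility E R \<gamma> \<mu> Innate \<le> abst_payoff E"
    using is_NE_best_response[OF NE abst, of Innate] by (simp add: utility_def)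
  have pay: "abst_payoff E \<le> part_payoff E" "0 < effort_cost E" "0 \<le> adv E" "fake_rate E < 1"
    using adm by (auto simp: admissible_def)
  have nonneg: "0 \<le> \<mu> s" for s using prof by (simp add: is_profile_def)
  show False
  proof (cases "\<mu> Abstain < 1 - adv E")
    case False
    then have "success_prob E \<mu> = 0" by (simp add: success_prob_def)
    then show False using le False some by (simp add: utility_def)
  next
    case True
    have reward: "R * success_prob E \<mu> / D \<le> 0"
      using le pay by (simp add: utility_def D_def)
    have "\<mu> Assisted = 0"
    proof (rule ccontr)
      assume "\<mu> Assisted \<noteq> 0"
      then have "utility E R \<gamma> \<mu> Innate \<le> utility E R \<gamma> \<mu> Assisted"
        using is_NE_best_response[OF NE] nonneg[of Assisted] by simp
      then have "effort_cost E \<le> (\<gamma> - 1) * (R * success_prob E \<mu> / D)"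
        using utility_gap[of E R \<gamma> \<mu>] by (simp add: D_def mult.assoc)
      also have "\<dots> \<le> 0" using reward \<open>1 < \<gamma>\<close> by (intro mult_nonneg_nonpos) auto
      finally show False using pay by simp
    qed
    then have "success_prob E \<mu> = 1 - fake_rate E"
      using success_prob_unassisted[OF adm prof _ True] proc[OF True] by blast
    moreover have "0 < D"
      using \<open>\<mu> Assisted = 0\<close> True prof pay by (simp add: is_profile_def D_def)
    ultimately have "0 < R * success_prob E \<mu> / D" using \<open>0 < R\<close> pay by simp
    then show False using reward by simp
  qed
qed

theorem theorem1:
  fixes E :: "'w platform" and \<eta> :: real and bstar :: "actuality \<Rightarrow> real"
    and g :: "actuality \<Rightarrow> real \<Rightarrow> real"
  assumes params: "admissible E"
    and process: "\<And>\<mu> u. is_profile E \<mu> \<Longrightarrow> \<mu> Abstain < 1 - adv E \<Longrightarrow> tagging_process E \<mu> u"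
    and standing: "\<And>\<mu> u. is_profile E \<mu> \<Longrightarrow> \<mu> Abstain < 1 - adv E \<Longrightarrow> standing_assumption E \<mu> u"
    and eta: "0 < \<eta>" "\<eta> < 1 - adv E"
    and g_def: "\<And>u \<beta>. g u \<beta> = ability E u * \<eta> +
          (1 - \<eta> - adv E) * response E (ability E u) (warning E \<beta>) - \<beta>"
    and B_i: "bstar Real_Post \<in> {0..target_adv E (mu_line E \<eta>) Real_Post}"
          "g Real_Post (bstar Real_Post) = 0"
    and B_ii: "bstar Fake_Post \<in> {target_adv E (mu_line E \<eta>) Fake_Post..1}"
          "g Fake_Post (bstar Fake_Post) = 0"
    and B_iii: "\<And>u \<beta>. \<beta> \<in> {0..1} \<Longrightarrow> g u \<beta> = 0 \<Longrightarrow> \<beta> = bstar u"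
    and B_iv: "\<And>u. \<exists>D<0. (g u has_real_derivative D) (at (bstar u) within {0..1})"
  shows "(\<forall>u. asymp_stable (g u) (bstar u) \<and> domain_of_attraction (g u) {bstar u} = {0..1}) \<and>
    (\<forall>\<gamma> R. \<gamma> > gamma_low E \<eta> \<and> R = effort_cost E * (1 - \<eta> - adv E + 1 / (\<gamma> - 1)) \<longrightarrow>
       (bstar Real_Post < target_adv E (mu_line E \<eta>) Real_Post \<and>
        bstar Fake_Post > target_adv E (mu_line E \<eta>) Fake_Post \<longrightarrow>
          is_AI_game E R \<gamma> \<and> is_AI_NE E R \<gamma> (mu_line E \<eta>)) \<and>
       (\<forall>x \<in> {0..<\<eta>} \<union> {1 - adv E}. \<not> is_NE E R \<gamma> (mu_line E x)) \<and>
       (\<forall>\<mu>. is_profile E \<mu> \<and> \<mu> Abstain > 0 \<and>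
            (\<mu> Abstain < 1 - adv E \<or> abst_payoff E < part_payoff E) \<longrightarrow>
          \<not> is_NE E R \<gamma> \<mu>))"
proof -
  define m where "m = 1 - \<eta> - adv E"
  have adm: "0 < fake_rate E" "fake_rate E < 1" "0 \<le> adv E" "0 < effort_cost E"
      "abst_payoff E \<le> part_payoff E"
    and target: "target E u \<le> 1" for u
    using params by (auto simp: admissible_def)
  have ability: "0 < ability E u" "ability E u < 1" for u
    using params by (cases u; auto simp: admissible_def)+
  have m: "0 < m" using eta by (simp add: m_def)
  have line_profile: "is_profile E (mu_line E x)" if "0 \<le> x" "x \<le> 1 - adv E" for x
    using that by (auto simp: is_profile_def mu_line_def split: action.split)
  have line_process: "tagging_process E (mu_line E x) u" if "0 \<le> x" "x \<le> 1 - adv E" for x u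
    using process[OF line_profile[OF that]] eta that by (simp add: mu_line_def)
  have drift_eq: "drift E (mu_line E \<eta>) u = g u" for u
    by (rule ext) (simp add: drift_mu_line g_def)

  have targets: "target_adv E (mu_line E \<eta>) u \<in> {0..1}" for u
  proof -
    have "target_adv E (mu_line E \<eta>) u = target E u * (1 - adv E)"
      by (simp add: target_adv_def eta_adv_def mu_line_def)
    moreover have "0 \<le> target E u" using ability[of u] params by (simp add: admissible_def less_imp_le)
    ultimately show ?thesis using adm target[of u] eta by (auto intro: mult_le_one)
  qed
  have b01: "bstar u \<in> {0..1}" for u
    using B_i(1) B_ii(1) targets[of u] by (cases u) auto
  have bzero: "g u (bstar u) = 0" for u using B_i(2) B_ii(2) by (cases u) auto
  have "\<exists>c>0. restoring (g u) (bstar u) c" for u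
  proof -
    obtain D where "D < 0" "(g u has_real_derivative D) (at (bstar u) within {0..1})"
      using B_iv by blast
    moreover have "continuous_on {0..1} (g u)"
    proof -
      obtain L where "L-lipschitz_on {0..1} (\<lambda>\<beta>. response E (ability E u) (warning E \<beta>))"
        using params unfolding admissible_def by blast
      note lipschitz_on_continuous_on[OF this]
      then show ?thesis unfolding g_def by (intro continuous_intros)
    qed
    moreover have "0 \<le> g u 0" "g u 1 \<le> 0"
    proof -
      have resp: "0 \<le> response E (ability E u) (warning E \<beta>)"
        "response E (ability E u) (warning E \<beta>) \<le> 1" if "\<beta> \<in> {0..1}" for \<beta>
        using params ability[of u] that by (auto simp: admissible_def response_def)
      show "0 \<le> g u 0"
        using resp[of 0] ability[of u] eta m by (simp add: g_def m_def)
      have "ability E u * \<eta> \<le> 1 * \<eta>" "m * response E (ability E u) (warning E 1) \<le> m * 1"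
        using resp[of 1] ability[of u] eta m by (intro mult_mono; simp)+
      then show "g u 1 \<le> 0" using adm by (simp add: g_def m_def)
    qed
    ultimately show ?thesis
      using restoring_if_unique_stable_zero b01 bzero B_iii by metis
  qed
  then obtain c where c: "\<And>u. 0 < c u" "\<And>u. restoring (g u) (bstar u) (c u)" by metis
  have stable: "asymp_stable (g u) (bstar u) \<and> domain_of_attraction (g u) {bstar u} = {0..1}" for u
    using restoring_asymp_stable[OF c(2,1) b01 bzero] by blast

  have game: "(bstar Real_Post < target_adv E (mu_line E \<eta>) Real_Post \<and>
        bstar Fake_Post > target_adv E (mu_line E \<eta>) Fake_Post \<longrightarrow>
          is_AI_game E R \<gamma> \<and> is_AI_NE E R \<gamma> (mu_line E \<eta>)) \<and>
       (\<forall>x \<in> {0..<\<eta>} \<union> {1 - adv E}. \<not> is_NE E R \<gamma> (mu_line E x)) \<and>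
       (\<forall>\<mu>. is_profile E \<mu> \<and> \<mu> Abstain > 0 \<and>
            (\<mu> Abstain < 1 - adv E \<or> abst_payoff E < part_payoff E) \<longrightarrow>
          \<not> is_NE E R \<gamma> \<mu>)"
    if \<gamma>: "\<gamma> > gamma_low E \<eta>" and R: "R = effort_cost E * (1 - \<eta> - adv E + 1 / (\<gamma> - 1))" for \<gamma> R
  proof -
    \<comment> \<open>This form shows that \<open>\<gamma> > 1\<close>, and it is equivalent to \<open>(1 - p) D \<eta> > 1\<close>, which drives the
      case \<open>x = 1 - \<mu>\<^sub>a\<close> below.\<close>
    have low: "gamma_low E \<eta> = 1 + fake_rate E / ((1 - fake_rate E) * m)"
    proof -
      have "\<eta> + adv E = 1 - m" by (simp add: m_def)
      then have "gamma_low E \<eta> = 1 / (1 - fake_rate E) * ((1 - (1 - m) * (1 - fake_rate E)) / m)"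
        by (simp add: gamma_low_def m_def)
      then show ?thesis using adm m by (simp add: field_simps)
    qed
    then have gt: "1 < \<gamma>" "fake_rate E < (\<gamma> - 1) * ((1 - fake_rate E) * m)"
    proof -
      have "0 < fake_rate E / ((1 - fake_rate E) * m)" using adm m by simp
      then show "1 < \<gamma>" using \<gamma> low by linarith
      have "fake_rate E / ((1 - fake_rate E) * m) < \<gamma> - 1" using \<gamma> low by linarith
      then show "fake_rate E < (\<gamma> - 1) * ((1 - fake_rate E) * m)"
        using adm m by (simp add: pos_divide_less_eq)
    qed
    have "0 < R" using gt m adm by (auto simp: R m_def[symmetric] intro!: mult_pos_pos add_pos_pos)
    define D where "D x = 1 + (\<gamma> - 1) * (1 - x - adv E)" for x
    have D: "mu_line E x Innate + adv E + \<gamma> * mu_line E x Assisted = D x" for x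
      by (simp add: mu_line_def D_def algebra_simps)
    \<comment> \<open>The choice of \<open>R\<close>: a certain success at \<open>\<mu>\<^sub>\<eta>\<close> pays back the effort exactly.\<close>
    have RD: "(\<gamma> - 1) * R = effort_cost E * D \<eta>"
      using gt by (simp add: R D_def field_simps)
    have gap: "utility E R \<gamma> (mu_line E x) Assisted - utility E R \<gamma> (mu_line E x) Innate =
        effort_cost E * (D \<eta> * success_prob E (mu_line E x) / D x - 1)" for x
      unfolding utility_gap D RD by (simp add: algebra_simps)
    have D_pos: "0 < D x" if "x \<le> 1 - adv E" for x
      using that gt by (simp add: D_def add_pos_nonneg)

    have AI: "is_AI_NE E R \<gamma> (mu_line E \<eta>)"
      if strict: "bstar Real_Post < target_adv E (mu_line E \<eta>) Real_Post"
        "bstar Fake_Post > target_adv E (mu_line E \<eta>) Fake_Post"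
    proof -
      have \<eta>: "0 \<le> \<eta>" "\<eta> \<le> 1 - adv E" using eta by auto
      note limits = tagging_process_threshold_limits[OF line_process[OF \<eta>]
          c(2)[folded drift_eq] c(1) b01]
      have one: "liminf_fake E (mu_line E \<eta>) = 1" "liminf_real E (mu_line E \<eta>) = 1"
        unfolding liminf_fake_def liminf_real_def
        by (intro real_liminf_eq_limit limits strict)+
      then have succ: "success_prob E (mu_line E \<eta>) = 1"
        using eta by (simp add: success_prob_def mu_line_def)
      have equal: "utility E R \<gamma> (mu_line E \<eta>) Assisted = utility E R \<gamma> (mu_line E \<eta>) Innate"
        using gap[of \<eta>] succ D_pos[OF \<eta>(2)] by simp
      have better: "utility E R \<gamma> (mu_line E \<eta>) Abstain \<le> utility E R \<gamma> (mu_line E \<eta>) Innate"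
      proof -
        have "0 \<le> R / D \<eta>" using \<open>0 < R\<close> D_pos[OF \<eta>(2)] by simp
        then show ?thesis using adm by (simp add: utility_def D[simplified] succ)
      qed
      have best: "utility E R \<gamma> (mu_line E \<eta>) s' \<le> utility E R \<gamma> (mu_line E \<eta>) s"
        if "0 < mu_line E \<eta> s" for s s'
      proof -
        have "s \<noteq> Abstain" using that by (auto simp: mu_line_def)
        then show ?thesis using equal better by (cases s; cases s') auto
      qed
      have "is_NE E R \<gamma> (mu_line E \<eta>)"
        unfolding is_NE_def is_arg_max_linorder
        using line_profile[OF \<eta>] best by blast
      then show ?thesis using one eta by (simp add: is_AI_NE_def mu_line_def)
    qed

    have not_NE: "\<not> is_NE E R \<gamma> (mu_line E x)" if x: "x \<in> {0..<\<eta>} \<union> {1 - adv E}" for x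
    proof
      assume NE: "is_NE E R \<gamma> (mu_line E x)"
      let ?P = "success_prob E (mu_line E x)"
      have x01: "0 \<le> x" "x \<le> 1 - adv E" using x eta by auto
      have particip: "mu_line E x Abstain < 1 - adv E" using eta by (simp add: mu_line_def)
      from x consider "x < \<eta>" | "x = 1 - adv E" by auto
      then show False
      proof cases
        case 1
        have "0 \<le> utility E R \<gamma> (mu_line E x) Assisted - utility E R \<gamma> (mu_line E x) Innate"
          using is_NE_best_response[OF NE, of Assisted Innate] 1 eta by (simp add: mu_line_def)
        then have "D x \<le> D \<eta> * ?P"
          using adm D_pos[OF x01(2)] unfolding gap by (simp add: zero_le_mult_iff field_simps)
        also have "\<dots> \<le> D \<eta>"
          using D_pos[of \<eta>] eta success_prob_le_1[OF params particip line_process[OF x01]]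
          by (simp add: mult_left_le)
        also have "\<dots> < D x" using 1 gt by (simp add: D_def)
        finally show False by simp
      next
        case 2
        have "utility E R \<gamma> (mu_line E x) Assisted - utility E R \<gamma> (mu_line E x) Innate \<le> 0"
          using is_NE_best_response[OF NE, of Innate Assisted] 2 eta by (simp add: mu_line_def)
        moreover have "mu_line E x Assisted = 0" using 2 by (simp add: mu_line_def)
        then have "?P = 1 - fake_rate E"
          using success_prob_unassisted[OF params line_profile[OF x01]] particip line_process[OF x01]
          by blast
        moreover have "D x = 1" using 2 by (simp add: D_def)
        ultimately have "D \<eta> * (1 - fake_rate E) \<le> 1"
          using adm unfolding gap by (simp add: mult_le_0_iff)
        moreover have "D \<eta> * (1 - fake_rate E) = 1 - fake_rate E + (\<gamma> - 1) * ((1 - fake_rate E) * m)"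
          by (simp add: D_def m_def algebra_simps)
        ultimately show False using gt(2) by simp
      qed
    qed

    show ?thesis
      using AI not_NE not_NE_if_abstaining[OF params _ _ _ _ gt(1) \<open>0 < R\<close>] process
      unfolding is_AI_game_def by blast
  qed
  show ?thesis using stable game by blast
qed

end
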